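(* Let $R$ be a henselian local ring with maximal ideal $\mathfrak{m}\neq\mathfrak{m}^2$ and residue field $k=R/\mathfrak{m}$. Let $n$ be a positive integer, let $m$ be the $\mathrm{char}(k)$-free part of $n$, and suppose $s_m(k)<\infty$. Assume that either $\mathrm{char}(k)\nmid n$, or $\mathrm{char}(R)=\mathrm{char}(k)$ and $R$ is reduced. Then $$w_n(R)=\begin{cases}\max\{w_m(k),\,s_m(k)+1\} & \text{if } m>1,\\ 1 & \text{if } m=1.\end{cases}$$
   Context: All rings are commutative with $1$. For a ring $A$ and a positive integer $n$: the $n$th level $s_n(A)$ is the smallest positive integer $g$ such that $-1$ is a sum of $g$ $n$th powers of elements of $A$ ($\infty$ if none); the $n$th Waring number $w_n(A)$ is the smallest positive integer $g$ such that every element of $A$ that is a sum of (finitely many) $n$th powers is a sum of at most $g$ $n$th powers ($\infty$ if none). For a prime $p$ and $n=p^{j}m$ with $p\nmid m$, $j\ge 0$, the $p$-free part of $n$ is $m$; the $0$-free part of $n$ is $n$ itself. A local ring $R$ with maximal ideal $\mathfrak{m}$ is henselian if for every $f\in R[x]$ and $b\in R$ with $f(b)\in\mathfrak{m}$, $f'(b)\notin\mathfrak{m}$ there is $a\in R$ with $f(a)=0$ and $a\equiv b \pmod{\mathfrak{m}}$. A ring is reduced if it has no nonzero nilpotents. *)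

theory Defs
  imports
    "HOL-Algebra.QuotRing"
    "HOL-Algebra.Ideal_Product"
    "HOL-Algebra.UnivPoly"
    "HOL-Library.Extended_Nat"
    "HOL-Computational_Algebra.Primes"
begin

definition sum_of_powers :: "('a, 'b) ring_scheme \<Rightarrow> nat \<Rightarrow> nat \<Rightarrow> 'a \<Rightarrow> bool" where
  "sum_of_powers A n g x \<longleftrightarrow>
     (\<exists>a \<in> {..<g} \<rightarrow> carrier A. x = (\<Oplus>\<^bsub>A\<^esub>i\<in>{..<g}. a i [^]\<^bsub>A\<^esub> n))"

(* In enat the infimum of a nonempty set is its minimum, and Inf {} = \<infinity>. *)

definition level :: "('a, 'b) ring_scheme \<Rightarrow> nat \<Rightarrow> enat" where
  "level A n = Inf {enat g | g. 0 < g \<and> sum_of_powers A n g (\<ominus>\<^bsub>A\<^esub> \<one>\<^bsub>A\<^esub>)}"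

definition waring_number :: "('a, 'b) ring_scheme \<Rightarrow> nat \<Rightarrow> enat" where
  "waring_number A n = Inf {enat g | g. 0 < g \<and>
     (\<forall>x \<in> carrier A. (\<exists>h. sum_of_powers A n h x) \<longrightarrow> (\<exists>h \<le> g. sum_of_powers A n h x))}"

definition ring_char :: "('a, 'b) ring_scheme \<Rightarrow> nat" where
  "ring_char A =
     (if \<exists>n > 0. add_pow A (n::nat) \<one>\<^bsub>A\<^esub> = \<zero>\<^bsub>A\<^esub>
      then LEAST n. 0 < n \<and> add_pow A n \<one>\<^bsub>A\<^esub> = \<zero>\<^bsub>A\<^esub>
      else 0)"

definition free_part :: "nat \<Rightarrow> nat \<Rightarrow> nat" where
  "free_part p n = (if p = 0 then n else n div p ^ multiplicity p n)"

lemma free_part_unique: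
  assumes "prime p" and "n = p ^ j * m" and "\<not> p dvd m"
  shows "free_part p n = m"
proof -
  have "p \<noteq> 0"
    using assms(1) by auto
  then have "multiplicity p n = j"
    using assms(2,3) by (intro multiplicity_eqI) auto
  with \<open>p \<noteq> 0\<close> assms(2) show ?thesis
    by (simp add: free_part_def)
qed

definition reduced_ring :: "('a, 'b) ring_scheme \<Rightarrow> bool" where
  "reduced_ring A \<longleftrightarrow> (\<forall>x \<in> carrier A. \<forall>i::nat. x [^]\<^bsub>A\<^esub> i = \<zero>\<^bsub>A\<^esub> \<longrightarrow> x = \<zero>\<^bsub>A\<^esub>)"

definition up_deriv :: "('a, 'b) ring_scheme \<Rightarrow> (nat \<Rightarrow> 'a) \<Rightarrow> nat \<Rightarrow> 'a" where
  "up_deriv A f = (\<lambda>i. add_pow A (Suc i) (coeff (UP A) f (Suc i)))"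

(* eval is unspecified outside carrier (UP A), so this closure property matters. *)
lemma (in ring) up_deriv_closed:
  assumes "f \<in> carrier (UP R)"
  shows "up_deriv R f \<in> carrier (UP R)"
proof -
  have f: "f \<in> up R" using assms by (simp add: UP_def)
  then obtain n where "bound \<zero> n f" by auto
  then have "f (Suc i) = \<zero>" if "n < i" for i
    using that by (auto simp: bound_def)
  then have "bound \<zero> n (\<lambda>i. add_pow R (Suc i) (f (Suc i)))"
    by (intro bound.intro) (simp del: add.nat_pow_Suc)
  moreover have "f i \<in> carrier R" for i
    using f by auto
  ultimately show ?thesis
    using f by (auto simp: up_deriv_def UP_def up_def simp del: add.nat_pow_Suc)
qed

locale local_ring = maximalideal M R + cring R for M and R (structure) +
  assumes maximal_unique: "maximalideal J R \<Longrightarrow> J = M"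

locale henselian_local_ring = local_ring +
  assumes henselian:
    "\<lbrakk>f \<in> carrier (UP R); b \<in> carrier R;
      eval R R id b f \<in> M; eval R R id b (up_deriv R f) \<notin> M\<rbrakk>
     \<Longrightarrow> \<exists>a \<in> carrier R. eval R R id a f = \<zero> \<and> a \<ominus> b \<in> M"

end

theory Submission
  imports Defs "HOL-Algebra.Multiplicative_Group"
begin

text \<open>
  If the residue characteristic does not divide \<open>n\<close>, Hensel's lemma applied to \<open>X\<^sup>n - u\<close> lifts
  nonzero \<open>n\<close>th powers from \<open>k\<close> to \<open>R\<close>; hence a representation of the residue of \<open>x\<close> as a sum of
  \<open>n\<close>th powers lifts to \<open>x\<close> as soon as one summand is nonzero. For a unit this is automatic, and for
  \<open>x \<in> M\<close> one lifts \<open>0 = 1 + (-1)\<close> with \<open>-1\<close> written as a sum of \<open>s\<^sub>n(k)\<close> powers.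
  Conversely, a representation of an element of \<open>M - M\<^sup>2\<close> must involve a unit when \<open>n > 1\<close>, and dividing
  by its power modulo \<open>M\<close> writes \<open>-1\<close> with one summand fewer.
  If \<open>p = char k = char R\<close> and \<open>n = p\<^sup>j m\<close>, then \<open>x \<mapsto> x\<^bsup>p\<^sup>j\<^esup>\<close> is a ring homomorphism, injective
  because \<open>R\<close> is reduced, so \<open>w\<^sub>n(R) = w\<^sub>m(R)\<close>.
\<close>

section \<open>Minima in \<open>enat\<close> compared through finite upper bounds\<close>

text \<open>The infimum of a nonempty set of \<open>enat\<close> values is attained. If no
  \<open>g\<close> satisfies \<open>P\<close>, the infimum is infinite and both sides fail.\<close>

lemma Inf_enat_le_iff:
  "Inf {enat g | g. P g} \<le> enat N \<longleftrightarrow> (\<exists>g\<le>N. P g)"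
proof
  assume le: "Inf {enat g | g. P g} \<le> enat N"
  have "{enat g | g. P g} \<noteq> {}"
  proof
    assume "{enat g | g. P g} = {}"
    then show False using le by (simp only: Inf_enat_def) simp
  qed
  then obtain y where "y \<in> {enat g | g. P g}" by blast
  then have "Inf {enat g | g. P g} \<in> {enat g | g. P g}"
    by (rule wellorder_InfI)
  then show "\<exists>g\<le>N. P g" using le by auto
next
  assume "\<exists>g\<le>N. P g"
  then obtain g where "g \<le> N" "P g" by blast
  then show "Inf {enat g | g. P g} \<le> enat N"
    by (intro Inf_lower2[of "enat g"]) auto
qed

text \<open>Equalities between Waring numbers and levels can thus be proved by comparing finite
  bounds \<open>N\<close>, with infinite values covered at the same time.\<close>

lemma enat_eqI:
  fixes x y :: enat
  assumes "\<And>N. x \<le> enat N \<longleftrightarrow> y \<le> enat N"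
  shows "x = y"
proof (rule antisym)
  show "x \<le> y" using assms by (cases y) auto
  show "y \<le> x" using assms by (cases x) auto
qed

text \<open>The bounding condition is monotone in \<open>g\<close>, so the existential over
  \<open>g \<le> N\<close> collapses to \<open>N\<close> itself.\<close>

lemma waring_number_le_iff:
  "waring_number A n \<le> enat N \<longleftrightarrow> 0 < N \<and>
     (\<forall>x \<in> carrier A. (\<exists>h. sum_of_powers A n h x) \<longrightarrow> (\<exists>h\<le>N. sum_of_powers A n h x))"
  unfolding waring_number_def Inf_enat_le_iff by (meson le_trans less_le_trans order_refl)

lemma level_le_iff:
  "level A n \<le> enat N \<longleftrightarrow>
     (\<exists>g\<le>N. 0 < g \<and> sum_of_powers A n g (\<ominus>\<^bsub>A\<^esub> \<one>\<^bsub>A\<^esub>))"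
  unfolding level_def Inf_enat_le_iff ..

section \<open>The characteristic of a ring\<close>

text \<open>Division with remainder by the least positive annihilator \<open>p\<close> of
  \<open>\<one>\<close> reduces \<open>n\<close> to \<open>n mod p\<close>, which minimality forces
  to be zero. In characteristic 0 both sides say \<open>n = 0\<close>.\<close>

lemma (in ring) ring_char_dvd_iff:
  "ring_char R dvd n \<longleftrightarrow> add_pow R n \<one> = \<zero>"
proof (cases "\<exists>k>0. add_pow R (k::nat) \<one> = \<zero>")
  case False
  then have "ring_char R = 0" by (simp only: ring_char_def if_False)
  with False show ?thesis by (metis add.nat_pow_0 dvd_0_left_iff gr0I)
next
  case True
  let ?P = "\<lambda>k. 0 < k \<and> add_pow R (k::nat) \<one> = \<zero>"
  define p where "p = ring_char R"
  have p_least: "p = (LEAST k. ?P k)"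
    using True unfolding p_def ring_char_def by simp
  have p: "?P p" unfolding p_least using True by (rule LeastI_ex)
  have "add_pow R n \<one> = add_pow R (p * (n div p) + n mod p) \<one>" by simp
  also have "\<dots> = add_pow R (p * (n div p)) \<one> \<oplus> add_pow R (n mod p) \<one>"
    by (simp only: add.nat_pow_mult[OF one_closed])
  also have "add_pow R (p * (n div p)) \<one> = \<zero>"
    using p add.nat_pow_pow[OF one_closed, of "n div p" p] by simp
  finally have "add_pow R n \<one> = add_pow R (n mod p) \<one>" by simp
  moreover have "add_pow R (n mod p) \<one> = \<zero> \<longleftrightarrow> n mod p = 0"
    using p not_less_Least[of "n mod p" ?P] unfolding p_least[symmetric] by auto
  ultimately show ?thesis unfolding p_def[symmetric] by (simp add: dvd_eq_mod_eq_0)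
qed

text \<open>Since \<open>(a * b)\<close> times \<open>\<one>\<close> is the product of the multiples
  by \<open>a\<close> and by \<open>b\<close>, the absence of zero divisors gives Euclid's property
  for the characteristic.\<close>

lemma (in domain) prime_ring_char:
  assumes "ring_char R \<noteq> 0"
  shows "prime (ring_char R)"
proof -
  have "\<not> is_unit (ring_char R)" using ring_char_dvd_iff[of 1] by simp
  moreover have "ring_char R dvd a \<or> ring_char R dvd b" if "ring_char R dvd a * b" for a b
  proof -
    have "add_pow R a \<one> \<otimes> add_pow R b \<one> = add_pow R (a * b) \<one>"
      using add_pow_ldistr[of \<one> "add_pow R b \<one>" a] add.nat_pow_pow[of \<one> a b]
      by (simp add: mult.commute[of b])
    also have "\<dots> = \<zero>" using that by (rule ring_char_dvd_iff[THEN iffD1])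
    finally have "add_pow R a \<one> = \<zero> \<or> add_pow R b \<one> = \<zero>"
      by (rule integral) simp_all
    then show ?thesis by (simp only: ring_char_dvd_iff)
  qed
  ultimately have "prime_elem (ring_char R)"
    using assms unfolding prime_elem_def by blast
  then show ?thesis by simp
qed

lemma (in domain) nat_pow_nonzero:
  "\<lbrakk>x \<in> carrier R; x \<noteq> \<zero>\<rbrakk> \<Longrightarrow> x [^] (n::nat) \<noteq> \<zero>"
  by (induct n) (simp_all add: integral_iff)

section \<open>The binomial theorem and the Frobenius map\<close>

lemma (in cring) binomial_expansion:
  assumes [simp]: "x \<in> carrier R" "y \<in> carrier R"
  shows "(x \<oplus> y) [^] n =
    (\<Oplus>i\<in>{..n}. add_pow R (n choose i) (x [^] i \<otimes> y [^] (n - i)))"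
proof (induction n)
  case 0
  show ?case by simp
next
  case (Suc n)
  define f where "f = (\<lambda>k i. add_pow R (k choose i) (x [^] i \<otimes> y [^] (k - i)))"
  \<comment> \<open>For \<open>i \<le> n\<close>, \<open>g i\<close> is \<open>y\<close> times
    \<open>f n i\<close>; at \<open>i = Suc n\<close> its binomial coefficient vanishes. The same
    family therefore serves in Pascal's rule (\<open>split\<close>) and may be summed up to
    \<open>Suc n\<close>.\<close>
  define g where "g i = add_pow R (n choose i) (x [^] i \<otimes> y [^] (Suc n - i))" for i
  have [simp]: "f k i \<in> carrier R" "g i \<in> carrier R" for k i
    by (simp_all add: f_def g_def)
  have IH: "(x \<oplus> y) [^] n = (\<Oplus>i\<in>{..n}. f n i)"
    using Suc by (simp add: f_def)
  have x: "x \<otimes> f n i = add_pow R (n choose i) (x [^] Suc i \<otimes> y [^] (n - i))" for i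
    by (simp add: f_def add_pow_rdistr m_ac)
  have y: "y \<otimes> f n i = g i" if "i \<le> n" for i
    using that by (simp add: f_def g_def add_pow_rdistr Suc_diff_le m_ac)
  have split: "f (Suc n) (Suc i) = x \<otimes> f n i \<oplus> g (Suc i)" for i
    unfolding x by (simp add: f_def g_def add.nat_pow_mult)
  have "(\<Oplus>i\<in>{..Suc n}. f (Suc n) i) =
      (\<Oplus>i\<in>{..n}. x \<otimes> f n i \<oplus> g (Suc i)) \<oplus> f (Suc n) 0"
    by (simp only: finsum_Suc2[OF Pi_I] split \<open>\<And>k i. f k i \<in> carrier R\<close>)
  also have "f (Suc n) 0 = g 0" by (simp add: f_def g_def)
  also have "(\<Oplus>i\<in>{..n}. x \<otimes> f n i \<oplus> g (Suc i)) \<oplus> g 0 =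
      (\<Oplus>i\<in>{..n}. x \<otimes> f n i) \<oplus> ((\<Oplus>i\<in>{..n}. g (Suc i)) \<oplus> g 0)"
    by (simp add: finsum_addf a_assoc)
  also have "(\<Oplus>i\<in>{..n}. g (Suc i)) \<oplus> g 0 = (\<Oplus>i\<in>{..Suc n}. g i)"
    by (subst finsum_Suc2) auto
  also have "\<dots> = g (Suc n) \<oplus> (\<Oplus>i\<in>{..n}. g i)"
    by (subst finsum_Suc) auto
  also have "g (Suc n) = \<zero>" by (simp add: g_def binomial_eq_0)
  also have "(\<Oplus>i\<in>{..n}. g i) = (\<Oplus>i\<in>{..n}. y \<otimes> f n i)"
    by (rule finsum_cong') (auto simp: y)
  also have "(\<Oplus>i\<in>{..n}. x \<otimes> f n i) \<oplus> (\<zero> \<oplus> (\<Oplus>i\<in>{..n}. y \<otimes> f n i)) =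
      (x \<oplus> y) [^] n \<otimes> (x \<oplus> y)"
    unfolding IH
    by (simp add: finsum_rdistr[symmetric] l_distr r_distr m_comm)
  finally show ?case by (simp add: f_def)
qed

lemma (in cring) add_pow_char_multiple:
  assumes "add_pow R (p::nat) \<one> = \<zero>" "p dvd k" "x \<in> carrier R"
  shows "add_pow R k x = \<zero>"
proof -
  have "ring_char R dvd k"
    by (rule dvd_trans[OF ring_char_dvd_iff[THEN iffD2, OF assms(1)] assms(2)])
  then have "add_pow R k \<one> = \<zero>"
    by (rule ring_char_dvd_iff[THEN iffD1])
  then show ?thesis
    using add_pow_ldistr[of \<one> x k] assms(3) by simp
qed

text \<open>A prime \<open>p\<close> divides every inner binomial coefficient, so only the two end
  terms of the expansion survive.\<close>

lemma (in cring) frobenius_add: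
  assumes "prime (p::nat)" "add_pow R p \<one> = \<zero>" and [simp]: "x \<in> carrier R" "y \<in> carrier R"
  shows "(x \<oplus> y) [^] p = x [^] p \<oplus> y [^] p"
proof -
  \<comment> \<open>As \<open>p\<close> is at least 2, the end terms are distinct and the inner
    indices are exactly \<open>Suc i\<close> with \<open>i \<le> k\<close>.\<close>
  obtain k where k: "p = Suc (Suc k)"
    using prime_ge_2_nat[OF assms(1)] by (metis Suc_le_D numeral_2_eq_2 Suc_le_mono)
  define f where "f = (\<lambda>i. add_pow R (p choose i) (x [^] i \<otimes> y [^] (p - i)))"
  have [simp]: "f i \<in> carrier R" for i by (simp add: f_def)
  have zero: "f (Suc i) = \<zero>" if "i \<le> k" for i
    unfolding f_def
    using that k by (intro add_pow_char_multiple[OF assms(2)] dvd_choose_prime assms(1)) auto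
  have "(x \<oplus> y) [^] p = (\<Oplus>i\<in>{..Suc (Suc k)}. f i)"
    by (subst binomial_expansion) (auto simp: f_def k)
  also have "\<dots> = f (Suc (Suc k)) \<oplus> ((\<Oplus>i\<in>{..k}. f (Suc i)) \<oplus> f 0)"
    by (subst finsum_Suc, simp, subst finsum_Suc2) auto
  also have "(\<Oplus>i\<in>{..k}. f (Suc i)) = (\<Oplus>i\<in>{..k}. \<zero>)"
    by (rule finsum_cong') (auto simp: zero)
  also have "f (Suc (Suc k)) \<oplus> ((\<Oplus>i\<in>{..k}. \<zero>) \<oplus> f 0) = x [^] p \<oplus> y [^] p"
    by (simp add: f_def k[symmetric])
  finally show ?thesis .
qed

lemma (in cring) frobenius_hom:
  assumes "prime (p::nat)" "add_pow R p \<one> = \<zero>"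
  shows "ring_hom_cring R R (\<lambda>x. x [^] (p ^ j))"
proof -
  have "(x \<oplus> y) [^] (p ^ j) = x [^] (p ^ j) \<oplus> y [^] (p ^ j)"
    if "x \<in> carrier R" "y \<in> carrier R" for x y
  proof (induction j)
    case (Suc j)
    have pow: "z [^] (p ^ Suc j) = (z [^] (p ^ j)) [^] p" if "z \<in> carrier R" for z
      using that by (simp add: nat_pow_pow mult.commute[of p])
    show ?case
      using that Suc by (simp add: pow frobenius_add[OF assms] del: power_Suc)
  qed (use that in simp)
  then show ?thesis
    by (intro ring_hom_cringI cring_axioms ring_hom_memI) (auto simp: nat_pow_distrib)
qed

section \<open>Sums of powers and their behaviour under homomorphisms\<close>

lemma (in cring) sum_of_powers_closed:
  "sum_of_powers R n g x \<Longrightarrow> x \<in> carrier R"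
  by (auto simp: sum_of_powers_def Pi_iff intro!: finsum_closed)

text \<open>Reindexing frees the summands from the index set \<open>{..<g}\<close>; this allows a
  summand to be removed from the middle of a representation.\<close>

lemma (in cring) sum_of_powers_finsum:
  assumes "finite A" "a \<in> A \<rightarrow> carrier R"
  shows "sum_of_powers R n (card A) (\<Oplus>i\<in>A. a i [^] n)"
proof -
  obtain b where b: "bij_betw b {..<card A} A"
    using ex_bij_betw_nat_finite[OF assms(1)] atLeast0LessThan by metis
  have "(\<Oplus>i\<in>A. a i [^] n) = (\<Oplus>i\<in>{..<card A}. a (b i) [^] n)"
    using finsum_reindex[of "\<lambda>i. a i [^] n" b "{..<card A}"] b assms(2)
    by (auto simp: bij_betw_def Pi_iff)
  then show ?thesis
    unfolding sum_of_powers_def using bij_betwE[OF b] assms(2)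
    by (intro bexI[of _ "a \<circ> b"]) (auto simp: Pi_iff)
qed

lemma (in cring) waring_number_one: "waring_number R 1 = 1"
proof -
  have "sum_of_powers R 1 1 x" if "x \<in> carrier R" for x
    using that sum_of_powers_finsum[of "{0::nat}" "\<lambda>_. x" 1] by simp
  then have "waring_number R 1 \<le> enat N \<longleftrightarrow> 1 \<le> enat N" for N
    unfolding waring_number_le_iff one_enat_def enat_ord_simps(1) by (metis One_nat_def Suc_le_eq)
  then show ?thesis by (rule enat_eqI)
qed

text \<open>Raising to the power \<open>q\<close> turns a sum of \<open>m\<close>th powers into a
  sum of equally many \<open>(q * m)\<close>th powers, and injectivity lets such representations be
  pulled back.\<close>

lemma (in cring) waring_number_pow_hom:
  assumes hom: "ring_hom_cring R R (\<lambda>x. x [^] (q::nat))"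
    and inj: "inj_on (\<lambda>x. x [^] q) (carrier R)"
  shows "waring_number R (q * m) = waring_number R m"
proof -
  interpret h: ring_hom_cring R R "\<lambda>x. x [^] q" by (rule hom)
  have pow: "(\<Oplus>i\<in>A. a i [^] m) [^] q = (\<Oplus>i\<in>A. a i [^] (q * m))"
    if "a \<in> A \<rightarrow> carrier R" for a :: "nat \<Rightarrow> 'a" and A
  proof -
    have "(\<Oplus>i\<in>A. a i [^] m) [^] q = (\<Oplus>i\<in>A. (a i [^] m) [^] q)"
      using that by (subst h.hom_finsum) (auto simp: o_def)
    also have "\<dots> = (\<Oplus>i\<in>A. a i [^] (q * m))"
      using that by (intro finsum_cong') (auto simp: nat_pow_pow mult.commute Pi_iff)
    finally show ?thesis .
  qed
  \<comment> \<open>Every sum of \<open>(q * m)\<close>th powers is itself a \<open>q\<close>th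
    power, so only elements in the image of the map have to be considered.\<close>
  have iff: "sum_of_powers R (q * m) g y \<longleftrightarrow> (\<exists>x\<in>carrier R. y = x [^] q \<and> sum_of_powers R m g x)"
    for g y
  proof
    assume "sum_of_powers R (q * m) g y"
    then obtain a where a: "a \<in> {..<g} \<rightarrow> carrier R" "y = (\<Oplus>i\<in>{..<g}. a i [^] (q * m))"
      unfolding sum_of_powers_def by blast
    then have x: "sum_of_powers R m g (\<Oplus>i\<in>{..<g}. a i [^] m)"
      unfolding sum_of_powers_def by blast
    show "\<exists>x\<in>carrier R. y = x [^] q \<and> sum_of_powers R m g x"
      using x sum_of_powers_closed[OF x] pow[OF a(1)] a(2) by metis
  next
    assume "\<exists>x\<in>carrier R. y = x [^] q \<and> sum_of_powers R m g x"
    then show "sum_of_powers R (q * m) g y"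
      unfolding sum_of_powers_def by (auto simp only: pow)
  qed
  have inj': "x [^] q = y [^] q \<longleftrightarrow> x = y" if "x \<in> carrier R" "y \<in> carrier R" for x y
    using inj_on_eq_iff[OF inj that] .
  have iff': "sum_of_powers R (q * m) g (x [^] q) \<longleftrightarrow> sum_of_powers R m g x"
    if "x \<in> carrier R" for g x
    unfolding iff using that inj' by blast
  have "waring_number R (q * m) \<le> enat N \<longleftrightarrow> waring_number R m \<le> enat N" for N
  proof -
    have "(\<forall>y\<in>carrier R. (\<exists>h. sum_of_powers R (q * m) h y) \<longrightarrow> (\<exists>h\<le>N. sum_of_powers R (q * m) h y))
      \<longleftrightarrow> (\<forall>x\<in>carrier R. (\<exists>h. sum_of_powers R m h x) \<longrightarrow> (\<exists>h\<le>N. sum_of_powers R m h x))"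
      (is "?L \<longleftrightarrow> ?R")
    proof
      assume L: ?L
      show ?R using L iff' nat_pow_closed by blast
    next
      assume R: ?R
      show ?L
      proof (intro ballI impI)
        fix y assume "\<exists>h. sum_of_powers R (q * m) h y"
        then obtain h x where x: "x \<in> carrier R" "y = x [^] q" "sum_of_powers R m h x"
          using iff by blast
        then obtain h' where "h' \<le> N" "sum_of_powers R m h' x" using R by blast
        then show "\<exists>h\<le>N. sum_of_powers R (q * m) h y" using iff'[OF x(1)] x(2) by blast
      qed
    qed
    then show ?thesis by (simp only: waring_number_le_iff)
  qed
  then show ?thesis by (rule enat_eqI)
qed

lemma (in ring_hom_cring) hom_add_pow:
  "x \<in> carrier R \<Longrightarrow> h (add_pow R (n::nat) x) = add_pow S n (h x)"
  by (induct n) auto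

lemma (in ring_hom_cring) hom_finsum_powers:
  assumes "a \<in> A \<rightarrow> carrier R"
  shows "h (\<Oplus>i\<in>A. a i [^] (n::nat)) = (\<Oplus>\<^bsub>S\<^esub>i\<in>A. h (a i) [^]\<^bsub>S\<^esub> n)"
proof -
  have "h (\<Oplus>i\<in>A. a i [^] n) = (\<Oplus>\<^bsub>S\<^esub>i\<in>A. h (a i [^] n))"
    using assms by (subst hom_finsum) (auto simp: o_def)
  also have "\<dots> = (\<Oplus>\<^bsub>S\<^esub>i\<in>A. h (a i) [^]\<^bsub>S\<^esub> n)"
    using assms by (intro S.finsum_cong') (auto simp: hom_pow Pi_iff)
  finally show ?thesis .
qed

lemma (in ring_hom_cring) sum_of_powers_hom:
  assumes "sum_of_powers R n g x"
  shows "sum_of_powers S n g (h x)"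
proof -
  obtain a where a: "a \<in> {..<g} \<rightarrow> carrier R" "x = (\<Oplus>i\<in>{..<g}. a i [^] n)"
    using assms unfolding sum_of_powers_def by blast
  show ?thesis
    unfolding sum_of_powers_def a(2) hom_finsum_powers[OF a(1)]
    using a(1) by (intro bexI[of _ "\<lambda>i. h (a i)"]) auto
qed

section \<open>Lifting powers and sums of powers from the residue field\<close>

text \<open>These are the three facts about the polynomial \<open>X^n - u\<close> that the henselian
  axiom asks for.\<close>

lemma (in UP_cring) nat_pow_minus_const:
  assumes u: "u \<in> carrier R" and b: "b \<in> carrier R" and n: "0 < n"
  defines "f \<equiv> monom P \<one> n \<ominus>\<^bsub>P\<^esub> monom P u 0"
  shows "f \<in> carrier P"
    and "eval R R id b f = b [^] n \<ominus> u"
    and "eval R R id b (up_deriv R f) = add_pow R n \<one> \<otimes> b [^] (n - 1)"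
proof -
  interpret UP_pre_univ_prop R R id by unfold_locales simp
  interpret ev: ring_hom_ring P R "eval R R id b"
    using eval_ring_hom[OF b] P.ring_axioms R.ring_axioms by (intro ring_hom_ringI2)
  show f: "f \<in> carrier P" using u by (simp add: f_def)
  have "eval R R id b f = eval R R id b (monom P \<one> n) \<ominus> eval R R id b (monom P u 0)"
    using u unfolding f_def by (simp add: P.minus_eq R.minus_eq)
  then show "eval R R id b f = b [^] n \<ominus> u"
    using u b by (simp add: eval_monom)
  \<comment> \<open>The derivative reads off coefficients of index \<open>Suc i\<close> only: the
    constant \<open>u\<close> drops out, and \<open>0 < n\<close> makes \<open>Suc i = n\<close>
    equivalent to \<open>i = n - 1\<close>.\<close>
  have "up_deriv R f = monom P (add_pow R n \<one>) (n - 1)"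
  proof (rule up_eqI)
    show "up_deriv R f \<in> carrier P" using R.up_deriv_closed f by (simp add: P_def)
    then have "coeff P (up_deriv R f) i = up_deriv R f i" for i
      by (simp add: P_def UP_def)
    moreover have "up_deriv R f i = add_pow R (Suc i) (coeff P f (Suc i))" for i
      by (simp add: up_deriv_def P_def)
    ultimately show "coeff P (up_deriv R f) i = coeff P (monom P (add_pow R n \<one>) (n - 1)) i" for i
      using u n by (auto simp: f_def R.minus_eq simp del: R.add.nat_pow_Suc)
  qed (intro monom_closed R.add.nat_pow_closed R.one_closed)
  then show "eval R R id b (up_deriv R f) = add_pow R n \<one> \<otimes> b [^] (n - 1)"
    using b by (simp add: eval_monom)
qed

text \<open>No finiteness of \<open>A\<close> is assumed: over an infinite set \<open>finsum\<close>
  is zero by default.\<close>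

lemma (in ideal) finsum_closed_ideal:
  "f \<in> A \<rightarrow> I \<Longrightarrow> finsum R f A \<in> I"
  by (induct A rule: infinite_finite_induct) (auto simp: Pi_iff finsum_insert)

context henselian_local_ring
begin

abbreviation K where "K \<equiv> R Quot M"
abbreviation res where "res \<equiv> (+>) M"

sublocale K: field K
  by (rule quotient_is_field[OF is_cring])

sublocale res: ring_hom_cring R K res
  by (rule rcos_ring_hom_cring[OF is_cring])

lemma res_eq_zero_iff:
  assumes "x \<in> carrier R"
  shows "res x = \<zero>\<^bsub>K\<^esub> \<longleftrightarrow> x \<in> M"
proof -
  have zero: "\<zero>\<^bsub>K\<^esub> = M" unfolding FactRing_def by simp
  show ?thesis
    unfolding zero using a_rcos_zero[OF is_ideal, of x] rcos_const_imp_mem[OF assms] by blast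
qed

lemma res_surj: "y \<in> carrier K \<Longrightarrow> \<exists>x\<in>carrier R. res x = y"
  unfolding FactRing_def A_RCOSETS_def' by auto

text \<open>Any lift \<open>b\<close> of \<open>c\<close> is an approximate root of
  \<open>X^n - u\<close>. The derivative there has residue \<open>n\<close> times the power
  \<open>n - 1\<close> of \<open>c\<close>, which is nonzero because the characteristic does not
  divide \<open>n\<close>.\<close>

lemma nth_root_lift:
  assumes n: "0 < n" "\<not> ring_char K dvd n"
    and u: "u \<in> carrier R" and c: "c \<in> carrier K" "c \<noteq> \<zero>\<^bsub>K\<^esub>" "res u = c [^]\<^bsub>K\<^esub> n"
  shows "\<exists>a\<in>carrier R. a [^] n = u"
proof -
  have UP: "UP_cring R" by (rule UP_cring.intro[OF is_cring])
  obtain b where b: "b \<in> carrier R" "res b = c" using res_surj c(1) by blast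
  let ?f = "monom (UP R) \<one> n \<ominus>\<^bsub>UP R\<^esub> monom (UP R) u 0"
  note f = UP_cring.nat_pow_minus_const[OF UP u _ n(1)]
  have "res (eval R R id b ?f) = \<zero>\<^bsub>K\<^esub>"
    unfolding f(2)[OF b(1)] using u b c by (simp add: minus_eq res.hom_pow K.r_neg)
  then have "eval R R id b ?f \<in> M"
    using u b by (subst res_eq_zero_iff[symmetric]) (simp_all add: f(2))
  moreover have "res (eval R R id b (up_deriv R ?f)) =
      add_pow K n \<one>\<^bsub>K\<^esub> \<otimes>\<^bsub>K\<^esub> c [^]\<^bsub>K\<^esub> (n - 1)"
    using b by (simp add: f(3) res.hom_pow res.hom_add_pow)
  then have "res (eval R R id b (up_deriv R ?f)) \<noteq> \<zero>\<^bsub>K\<^esub>"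
    using n(2) c K.ring_char_dvd_iff[of n] K.nat_pow_nonzero[of c "n - 1"]
    by (simp add: K.integral_iff)
  then have "eval R R id b (up_deriv R ?f) \<notin> M"
    using b by (subst res_eq_zero_iff[symmetric]) (simp_all add: f(3))
  ultimately obtain a where a: "a \<in> carrier R" "eval R R id a ?f = \<zero>"
    using henselian[OF f(1)[OF b(1)] b(1)] by blast
  then have "a [^] n = u"
    using f(2)[OF a(1)] a u by simp
  with a(1) show ?thesis ..
qed

text \<open>All summands but the \<open>j\<close>th are lifted arbitrarily, with sum
  \<open>t\<close>. The \<open>j\<close>th absorbs the error: \<open>x \<ominus> t\<close> has the
  nonzero residue of an \<open>n\<close>th power, hence is an \<open>n\<close>th power in
  \<open>R\<close>.\<close>

lemma sum_of_powers_lift: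
  assumes n: "0 < n" "\<not> ring_char K dvd n"
    and x: "x \<in> carrier R"
    and c: "c \<in> {..<g} \<rightarrow> carrier K" "res x = (\<Oplus>\<^bsub>K\<^esub>i\<in>{..<g}. c i [^]\<^bsub>K\<^esub> n)"
    and j: "j < g" "c j \<noteq> \<zero>\<^bsub>K\<^esub>"
  shows "sum_of_powers R n g x"
proof -
  have "\<forall>i\<in>{..<g}. \<exists>b\<in>carrier R. res b = c i" using c(1) res_surj by blast
  then obtain b where b: "\<And>i. i < g \<Longrightarrow> b i \<in> carrier R" "\<And>i. i < g \<Longrightarrow> res (b i) = c i"
    by (metis lessThan_iff)
  let ?A = "{..<g} - {j}"
  have split: "{..<g} = insert j ?A" using j(1) by auto
  define t where "t = (\<Oplus>i\<in>?A. b i [^] n)"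
  have t: "t \<in> carrier R" using b unfolding t_def by (intro finsum_closed) auto
  have res_t: "res t = (\<Oplus>\<^bsub>K\<^esub>i\<in>?A. c i [^]\<^bsub>K\<^esub> n)"
  proof -
    have "res t = (\<Oplus>\<^bsub>K\<^esub>i\<in>?A. res (b i) [^]\<^bsub>K\<^esub> n)"
      unfolding t_def using b by (intro res.hom_finsum_powers) auto
    also have "\<dots> = (\<Oplus>\<^bsub>K\<^esub>i\<in>?A. c i [^]\<^bsub>K\<^esub> n)"
      using b c(1) by (intro K.finsum_cong') (auto simp: Pi_iff)
    finally show ?thesis .
  qed
  have "res x = c j [^]\<^bsub>K\<^esub> n \<oplus>\<^bsub>K\<^esub> res t"
    unfolding c(2) res_t using c(1) j(1) by (subst split, subst K.finsum_insert) auto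
  then have "res (x \<ominus> t) = c j [^]\<^bsub>K\<^esub> n"
    using x t c(1) j(1) by (simp add: minus_eq K.a_assoc K.r_neg Pi_iff)
  then obtain a where a: "a \<in> carrier R" "a [^] n = x \<ominus> t"
    using nth_root_lift[OF n, of "x \<ominus> t" "c j"] x t c(1) j by auto
  have "(\<Oplus>i\<in>{..<g}. (b(j := a)) i [^] n) = a [^] n \<oplus> (\<Oplus>i\<in>?A. (b(j := a)) i [^] n)"
    using a b x t by (subst split, subst finsum_insert) auto
  also have "(\<Oplus>i\<in>?A. (b(j := a)) i [^] n) = t"
    unfolding t_def using b by (intro finsum_cong') auto
  also have "a [^] n \<oplus> t = x"
    using a x t by (simp add: minus_eq a_assoc l_neg)
  finally show ?thesis
    unfolding sum_of_powers_def using a b by (intro bexI[of _ "b(j := a)"]) auto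
qed

lemma sum_of_powers_level_Suc:
  assumes n: "0 < n" "\<not> ring_char K dvd n"
    and s: "sum_of_powers K n s (\<ominus>\<^bsub>K\<^esub> \<one>\<^bsub>K\<^esub>)" and x: "x \<in> M"
  shows "sum_of_powers R n (Suc s) x"
proof -
  obtain c where c: "c \<in> {..<s} \<rightarrow> carrier K"
      "\<ominus>\<^bsub>K\<^esub> \<one>\<^bsub>K\<^esub> = (\<Oplus>\<^bsub>K\<^esub>i\<in>{..<s}. c i [^]\<^bsub>K\<^esub> n)"
    using s unfolding sum_of_powers_def by blast
  \<comment> \<open>The appended summand \<open>\<one>\<close>, at index \<open>s\<close>, cancels
    the representation of \<open>-1\<close> and is the nonzero summand on which the lifting
    relies.\<close>
  let ?c = "c(s := \<one>\<^bsub>K\<^esub>)"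
  have xR: "x \<in> carrier R" using x by (rule Icarr)
  have "(\<Oplus>\<^bsub>K\<^esub>i\<in>{..<Suc s}. ?c i [^]\<^bsub>K\<^esub> n) =
      \<one>\<^bsub>K\<^esub> \<oplus>\<^bsub>K\<^esub> (\<Oplus>\<^bsub>K\<^esub>i\<in>{..<s}. ?c i [^]\<^bsub>K\<^esub> n)"
    unfolding lessThan_Suc using c(1) by (subst K.finsum_insert) (auto simp: Pi_iff)
  also have "(\<Oplus>\<^bsub>K\<^esub>i\<in>{..<s}. ?c i [^]\<^bsub>K\<^esub> n) = \<ominus>\<^bsub>K\<^esub> \<one>\<^bsub>K\<^esub>"
    unfolding c(2) using c(1) by (intro K.finsum_cong') (auto simp: Pi_iff)
  also have "\<one>\<^bsub>K\<^esub> \<oplus>\<^bsub>K\<^esub> \<ominus>\<^bsub>K\<^esub> \<one>\<^bsub>K\<^esub> = res x"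
    using x res_eq_zero_iff[OF xR] K.r_neg[OF K.one_closed] by simp
  finally have "res x = (\<Oplus>\<^bsub>K\<^esub>i\<in>{..<Suc s}. ?c i [^]\<^bsub>K\<^esub> n)" ..
  then show ?thesis
    using c(1) by (intro sum_of_powers_lift[OF n xR, of ?c _ s]) (auto simp: Pi_iff)
qed

text \<open>Only the residue of \<open>x\<close> is prescribed, so arbitrary lifts of the bases
  suffice, without Hensel's lemma. This transfers Waring bounds from \<open>R\<close> down to
  \<open>K\<close>.\<close>

lemma sum_of_powers_lift_surj:
  assumes "sum_of_powers K n g y"
  shows "\<exists>x\<in>carrier R. sum_of_powers R n g x \<and> res x = y"
proof -
  obtain c where c: "c \<in> {..<g} \<rightarrow> carrier K" "y = (\<Oplus>\<^bsub>K\<^esub>i\<in>{..<g}. c i [^]\<^bsub>K\<^esub> n)"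
    using assms unfolding sum_of_powers_def by blast
  have "\<forall>i\<in>{..<g}. \<exists>b\<in>carrier R. res b = c i" using c(1) res_surj by blast
  then obtain b where b: "b \<in> {..<g} \<rightarrow> carrier R" "\<And>i. i < g \<Longrightarrow> res (b i) = c i"
    by (metis lessThan_iff Pi_I)
  let ?x = "\<Oplus>i\<in>{..<g}. b i [^] n"
  have "res ?x = y"
    unfolding c(2) res.hom_finsum_powers[OF b(1)] using b c(1)
    by (intro K.finsum_cong') (auto simp: Pi_iff)
  moreover have "sum_of_powers R n g ?x" using b(1) unfolding sum_of_powers_def by blast
  ultimately show ?thesis using sum_of_powers_closed by blast
qed

section \<open>The lower bound from elements of \<open>M\<close> outside its square, and the
  resulting formula\<close>

text \<open>If every base were in \<open>M\<close>, each power would lie in the square of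
  \<open>M\<close> because \<open>n\<close> is at least 2. So some base has nonzero residue, and
  scaling the residue relation by the \<open>n\<close>th power of its inverse turns that summand
  into \<open>\<one>\<close>.\<close>

lemma level_Suc_le:
  assumes n: "1 < n" and x: "x \<in> M" "x \<notin> ideal_prod R M M"
    and g: "sum_of_powers R n g x"
  shows "level K n + 1 \<le> enat g"
proof -
  obtain a where a: "a \<in> {..<g} \<rightarrow> carrier R" "x = (\<Oplus>i\<in>{..<g}. a i [^] n)"
    using g unfolding sum_of_powers_def by blast
  interpret MM: ideal "ideal_prod R M M" R by (rule ideal_prod_is_ideal[OF is_ideal is_ideal])
  have "\<exists>j<g. a j \<notin> M"
  proof (rule ccontr)
    assume "\<not> ?thesis"
    then have aM: "a i \<in> M" if "i < g" for i using that by blast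
    obtain k where k: "n = Suc (Suc k)" using n by (metis less_imp_Suc_add plus_1_eq_Suc)
    have "a i [^] n \<in> ideal_prod R M M" if "i < g" for i
    proof -
      have "a i [^] n = a i [^] k \<otimes> (a i \<otimes> a i)"
        using Icarr[OF aM[OF that]] by (simp add: k m_assoc)
      then show ?thesis
        using aM[OF that] by (simp add: MM.I_l_closed ideal_prod.prod Icarr)
    qed
    then have "x \<in> ideal_prod R M M"
      unfolding a(2) by (intro MM.finsum_closed_ideal) auto
    with x(2) show False ..
  qed
  then obtain j where j: "j < g" "a j \<notin> M" by blast
  let ?A = "{..<g} - {j}"
  define c where "c i = res (a i)" for i
  have c: "c i \<in> carrier K" if "i < g" for i using a(1) that by (auto simp: c_def)
  have cj: "c j \<noteq> \<zero>\<^bsub>K\<^esub>" using a(1) j res_eq_zero_iff by (auto simp: c_def)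
  define v where "v = inv\<^bsub>K\<^esub> (c j)"
  have v: "v \<in> carrier K" "v \<otimes>\<^bsub>K\<^esub> c j = \<one>\<^bsub>K\<^esub>"
    using c[OF j(1)] cj K.field_Units by (auto simp: v_def)
  have "\<zero>\<^bsub>K\<^esub> = res x" using x(1) res_eq_zero_iff[OF Icarr[OF x(1)]] by simp
  also have "\<dots> = (\<Oplus>\<^bsub>K\<^esub>i\<in>{..<g}. c i [^]\<^bsub>K\<^esub> n)"
    unfolding a(2) res.hom_finsum_powers[OF a(1)] by (simp add: c_def)
  finally have "\<zero>\<^bsub>K\<^esub> = v [^]\<^bsub>K\<^esub> n \<otimes>\<^bsub>K\<^esub> (\<Oplus>\<^bsub>K\<^esub>i\<in>{..<g}. c i [^]\<^bsub>K\<^esub> n)"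
    using v(1) by (metis K.nat_pow_closed K.r_null)
  also have "\<dots> = (\<Oplus>\<^bsub>K\<^esub>i\<in>{..<g}. v [^]\<^bsub>K\<^esub> n \<otimes>\<^bsub>K\<^esub> c i [^]\<^bsub>K\<^esub> n)"
    using v c by (intro K.finsum_rdistr) auto
  also have "\<dots> = (\<Oplus>\<^bsub>K\<^esub>i\<in>{..<g}. (v \<otimes>\<^bsub>K\<^esub> c i) [^]\<^bsub>K\<^esub> n)"
    using v c by (intro K.finsum_cong') (auto simp: K.nat_pow_distrib)
  also have "{..<g} = insert j ?A" using j(1) by auto
  also have "(\<Oplus>\<^bsub>K\<^esub>i\<in>insert j ?A. (v \<otimes>\<^bsub>K\<^esub> c i) [^]\<^bsub>K\<^esub> n) =
      \<one>\<^bsub>K\<^esub> \<oplus>\<^bsub>K\<^esub> (\<Oplus>\<^bsub>K\<^esub>i\<in>?A. (v \<otimes>\<^bsub>K\<^esub> c i) [^]\<^bsub>K\<^esub> n)"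
    using v c j(1) by (subst K.finsum_insert) auto
  finally have sum: "\<one>\<^bsub>K\<^esub> \<oplus>\<^bsub>K\<^esub> (\<Oplus>\<^bsub>K\<^esub>i\<in>?A. (v \<otimes>\<^bsub>K\<^esub> c i) [^]\<^bsub>K\<^esub> n) = \<zero>\<^bsub>K\<^esub>" ..
  have "(\<Oplus>\<^bsub>K\<^esub>i\<in>?A. (v \<otimes>\<^bsub>K\<^esub> c i) [^]\<^bsub>K\<^esub> n) \<in> carrier K"
    using v c by (intro K.finsum_closed) auto
  then have neg: "(\<Oplus>\<^bsub>K\<^esub>i\<in>?A. (v \<otimes>\<^bsub>K\<^esub> c i) [^]\<^bsub>K\<^esub> n) = \<ominus>\<^bsub>K\<^esub> \<one>\<^bsub>K\<^esub>"
    using sum by (metis K.a_comm K.minus_equality K.one_closed)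
  have "sum_of_powers K n (card ?A) (\<ominus>\<^bsub>K\<^esub> \<one>\<^bsub>K\<^esub>)"
    unfolding neg[symmetric] using v c by (intro K.sum_of_powers_finsum) auto
  then have power: "sum_of_powers K n (g - 1) (\<ominus>\<^bsub>K\<^esub> \<one>\<^bsub>K\<^esub>)" using j(1) by simp
  \<comment> \<open>The level counts only positive numbers of summands. An empty sum would be zero,
    which is not \<open>-1\<close>, so \<open>g - 1\<close> is positive.\<close>
  have "\<ominus>\<^bsub>K\<^esub> \<one>\<^bsub>K\<^esub> \<noteq> \<zero>\<^bsub>K\<^esub>" by (metis K.add.inv_eq_1_iff K.one_closed K.zero_not_one)
  then have "g - 1 \<noteq> 0" using power by (auto simp: sum_of_powers_def)
  then have "level K n \<le> enat (g - 1)" using power level_le_iff by blast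
  then have "level K n + 1 \<le> enat (g - 1) + 1" by (rule add_right_mono)
  then show ?thesis using j(1) by (simp add: one_enat_def)
qed

theorem waring_number_char_not_dvd:
  assumes M2: "M \<noteq> ideal_prod R M M"
    and n: "1 < n" "\<not> ring_char K dvd n" and fin: "level K n < \<infinity>"
  shows "waring_number R n = max (waring_number K n) (level K n + 1)"
proof (rule enat_eqI)
  fix N
  obtain s where s: "level K n = enat s" using fin by (cases "level K n") auto
  \<comment> \<open>The level is attained: some \<open>t \<le> s\<close> represents
    \<open>-1\<close>, and minimality forces \<open>t = s\<close>.\<close>
  obtain t where t: "t \<le> s" "0 < t" "sum_of_powers K n t (\<ominus>\<^bsub>K\<^esub> \<one>\<^bsub>K\<^esub>)"
    using level_le_iff[of K n s] s by auto
  then have "level K n \<le> enat t" using level_le_iff by blast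
  then have ts: "t = s" using t s by simp
  have n0: "0 < n" using n by simp
  obtain x0 where x0: "x0 \<in> M" "x0 \<notin> ideal_prod R M M"
    using M2 ideal_prod_inter[OF is_ideal is_ideal] by blast
  have M_sum: "sum_of_powers R n (Suc s) x" if "x \<in> M" for x
    using sum_of_powers_level_Suc[OF n0 n(2) _ that] t ts by blast
  have "waring_number K n \<le> enat N \<and> Suc s \<le> N" if "waring_number R n \<le> enat N"
  proof
    have N: "0 < N" "\<And>x h. \<lbrakk>x \<in> carrier R; sum_of_powers R n h x\<rbrakk> \<Longrightarrow> \<exists>h\<le>N. sum_of_powers R n h x"
      using that unfolding waring_number_le_iff by blast+
    \<comment> \<open>A sum of powers in \<open>K\<close> is lifted to \<open>R\<close>, shortened
      there to at most \<open>N\<close> summands, and reduced again.\<close>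
    show "waring_number K n \<le> enat N"
      unfolding waring_number_le_iff
      using N sum_of_powers_lift_surj res.sum_of_powers_hom by metis
    \<comment> \<open>The Waring bound speaks only about sums of powers; \<open>M_sum\<close> shows
      that \<open>x0\<close> is one.\<close>
    obtain h where h: "h \<le> N" "sum_of_powers R n h x0"
      using N(2) M_sum[OF x0(1)] x0(1) Icarr by blast
    show "Suc s \<le> N"
      using level_Suc_le[OF n(1) x0 h(2)] h(1) s by (simp add: one_enat_def)
  qed
  moreover have "waring_number R n \<le> enat N" if K: "waring_number K n \<le> enat N" and sN: "Suc s \<le> N"
    unfolding waring_number_le_iff
  proof (intro conjI ballI impI)
    fix x assume x: "x \<in> carrier R" and ex: "\<exists>h. sum_of_powers R n h x"
    show "\<exists>h\<le>N. sum_of_powers R n h x"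
    proof (cases "x \<in> M")
      case True
      then show ?thesis using M_sum sN by blast
    next
      case False
      obtain h where h: "h \<le> N" "sum_of_powers K n h (res x)"
        using K ex x res.sum_of_powers_hom unfolding waring_number_le_iff by (meson res.hom_closed)
      obtain c where c: "c \<in> {..<h} \<rightarrow> carrier K" "res x = (\<Oplus>\<^bsub>K\<^esub>i\<in>{..<h}. c i [^]\<^bsub>K\<^esub> n)"
        using h(2) unfolding sum_of_powers_def by blast
      \<comment> \<open>Outside \<open>M\<close> the residue is nonzero, whereas zero bases would
        give zero, as \<open>n\<close> is positive.\<close>
      have "\<exists>j<h. c j \<noteq> \<zero>\<^bsub>K\<^esub>"
      proof (rule ccontr)
        assume "\<not> ?thesis"
        then have "res x = (\<Oplus>\<^bsub>K\<^esub>i\<in>{..<h}. \<zero>\<^bsub>K\<^esub>)"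
          unfolding c(2) using n0 by (intro K.finsum_cong') (auto simp: K.nat_pow_zero)
        then show False using False x res_eq_zero_iff by simp
      qed
      then show ?thesis using sum_of_powers_lift[OF n0 n(2) x c] h(1) by blast
    qed
  qed (use sN in simp)
  ultimately show "waring_number R n \<le> enat N \<longleftrightarrow>
      max (waring_number K n) (level K n + 1) \<le> enat N"
    by (auto simp: s one_enat_def)
qed

end

section \<open>Reduction of the exponent to its free part\<close>

text \<open>Additivity turns equal powers of \<open>x\<close> and \<open>y\<close> into a vanishing
  power of \<open>x \<ominus> y\<close>, which must be zero in a reduced ring.\<close>

lemma (in cring) inj_on_nat_pow_of_reduced:
  assumes "reduced_ring R" and hom: "ring_hom_cring R R (\<lambda>x. x [^] (q::nat))"
  shows "inj_on (\<lambda>x. x [^] q) (carrier R)"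
proof (rule inj_onI)
  interpret h: ring_hom_cring R R "\<lambda>x. x [^] q" by (rule hom)
  fix x y assume xy: "x \<in> carrier R" "y \<in> carrier R" "x [^] q = y [^] q"
  then have "(x \<ominus> y) [^] q = \<zero>"
    by (simp add: minus_eq h.hom_add h.hom_a_inv r_neg del: h.hom_closed)
  then have "x \<ominus> y = \<zero>" using assms(1) xy unfolding reduced_ring_def by blast
  then show "x = y" using xy by simp
qed

theorem corollary3p3:
  fixes R :: "('a, 'b) ring_scheme" and M :: "'a set" and n m :: nat
  assumes "henselian_local_ring M R"
    and "M \<noteq> ideal_prod R M M"
    and "n > 0"
    and "m = free_part (ring_char (R Quot M)) n"
    and "level (R Quot M) m < \<infinity>"
    and "\<not> ring_char (R Quot M) dvd n \<or>
         (ring_char R = ring_char (R Quot M) \<and> reduced_ring R)"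
  shows "waring_number R n =
    (if m > 1 then max (waring_number (R Quot M) m) (level (R Quot M) m + 1) else 1)"
proof -
  interpret henselian_local_ring M R by (rule assms(1))
  define p where "p = ring_char K"
  \<comment> \<open>Residue characteristic 0 falls under the case where \<open>p\<close> does not
    divide \<open>n\<close>, since \<open>n\<close> is positive; there \<open>m = n\<close>.
    Otherwise \<open>p\<close> is prime and the map with exponent \<open>p ^ j\<close> removes the
    factor \<open>p ^ j\<close>.\<close>
  have reduction: "0 < m \<and> \<not> p dvd m \<and> waring_number R n = waring_number R m"
  proof (cases "p dvd n")
    case False
    then have "m = n"
      using assms(4) by (simp add: p_def[symmetric] free_part_def not_dvd_imp_multiplicity_0)
    then show ?thesis using False assms(3) by simp
  next
    case True
    then have p0: "p \<noteq> 0" using assms(3) by auto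
    then have p: "prime p" using K.prime_ring_char p_def by simp
    have char: "ring_char R = p" and red: "reduced_ring R"
      using assms(6) True by (auto simp: p_def)
    define j where "j = multiplicity p n"
    have m: "m = n div p ^ j"
      using assms(4) p0 by (simp add: p_def[symmetric] free_part_def j_def)
    have n: "n = p ^ j * m" unfolding m j_def by (simp add: multiplicity_dvd)
    have "\<not> p dvd m"
      unfolding m j_def using assms(3) p
      by (intro multiplicity_decompose) auto
    moreover have "0 < m" using n assms(3) by (cases m) auto
    moreover have "add_pow R p \<one>\<^bsub>R\<^esub> = \<zero>\<^bsub>R\<^esub>" using ring_char_dvd_iff[of p] char by simp
    then have hom: "ring_hom_cring R R (\<lambda>x. x [^]\<^bsub>R\<^esub> (p ^ j))" by (rule frobenius_hom[OF p])
    have "waring_number R n = waring_number R m"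
      unfolding n by (rule waring_number_pow_hom[OF hom inj_on_nat_pow_of_reduced[OF red hom]])
    ultimately show ?thesis by simp
  qed
  show ?thesis
  proof (cases "m > 1")
    case True
    then show ?thesis
      using waring_number_char_not_dvd[OF assms(2) True _ assms(5)] reduction p_def by simp
  next
    case False
    then have "m = 1" using reduction by simp
    then show ?thesis using reduction waring_number_one by simp
  qed
qed

end
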